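(* Let $X_n=(X_n^{(1)},\ldots,X_n^{(m)})$ and $Y_n=(Y_n^{(1)},\ldots,Y_n^{(k)})$ be random vectors in $\mathbb{R}^m$ and $\mathbb{R}^k$, all defined on one probability space, such that for every $n$ the joint distribution $P_{(X_n,Y_n)}$ is Gaussian. Let $\mathbb{E}X_n=a_n$, $\mathbb{E}Y_n=b_n$ and $r_n^{i,j}=\mathrm{cov}\{X_n^{(i)},Y_n^{(j)}\}$ for $1\le i\le m$, $1\le j\le k$. The following conditions are equivalent: 1) The sequences $(P_{X_n})$, $(P_{Y_n})$ are tight and $(X_n),(Y_n)$ satisfy condition AI-1. 2) The sequences $(a_n)$, $(b_n)$, $(\mathbb{E}|X_n|^2)$, $(\mathbb{E}|Y_n|^2)$ are bounded and, for all $i,j$ with $1\le i\le m$, $1\le j\le k$, $r_n^{i,j}\to 0$ as $n\to+\infty$.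
   Context: $P_\xi$ denotes the distribution of $\xi$; $\mathbb{R}^m,\mathbb{R}^k$ carry their Euclidean metrics and $\mathbb{R}^m\times\mathbb{R}^k$ the sum (equivalently, maximum) metric. AI-1: for all bounded uniformly continuous functions $h:\mathbb{R}^m\times\mathbb{R}^k\to\mathbb{R}$, $\int h(x,y)\,P_{(X_n,Y_n)}(dx,dy)-\int h(x,y)\,(P_{X_n}\times P_{Y_n})(dx,dy)\to 0$ as $n\to+\infty$. *)

theory Defs
  imports "HOL-Probability.Probability"
begin

text \<open>Degenerate (Dirac) distributions count as Gaussian. They are listed separately because
  \<^const>\<open>normal_density\<close> is a probability density only for a positive standard deviation.\<close>

definition gaussian_real :: "real measure \<Rightarrow> bool" where
  "gaussian_real N \<longleftrightarrow>
     (\<exists>\<mu>. N = return borel \<mu>) \<or>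
     (\<exists>\<mu> \<sigma>. \<sigma> > 0 \<and> N = density lborel (\<lambda>x. ennreal (normal_density \<mu> \<sigma> x)))"

definition gaussian :: "'a::euclidean_space measure \<Rightarrow> bool" where
  "gaussian N \<longleftrightarrow>
     prob_space N \<and> sets N = sets borel \<and>
     (\<forall>f :: 'a \<Rightarrow> real. linear f \<longrightarrow> gaussian_real (distr N borel f))"

text \<open>The library constant \<^const>\<open>tight\<close> only covers measures on the real line.\<close>

definition tight_seq :: "(nat \<Rightarrow> 'a::topological_space measure) \<Rightarrow> bool" where
  "tight_seq \<mu> \<longleftrightarrow>
     (\<forall>\<epsilon>>0. \<exists>K. compact K \<and> (\<forall>n. measure (\<mu> n) (- K) < \<epsilon>))"

definition covariance :: "'w measure \<Rightarrow> ('w \<Rightarrow> real) \<Rightarrow> ('w \<Rightarrow> real) \<Rightarrow> real" where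
  "covariance M U V =
     (\<integral>\<omega>. (U \<omega> - (\<integral>\<omega>'. U \<omega>' \<partial>M)) * (V \<omega> - (\<integral>\<omega>'. V \<omega>' \<partial>M)) \<partial>M)"

text \<open>The product type carries the metric \<open>sqrt (d1\<^sup>2 + d2\<^sup>2)\<close>; by the following lemma it has
  the same uniformly continuous functions as the sum metric.\<close>

lemma uniformly_continuous_on_sum_metric_iff:
  fixes h :: "'a::metric_space \<times> 'b::metric_space \<Rightarrow> real"
  shows "uniformly_continuous_on UNIV h \<longleftrightarrow>
    (\<forall>e>0. \<exists>d>0. \<forall>x y x' y'. dist x x' + dist y y' < d \<longrightarrow> dist (h (x, y)) (h (x', y')) < e)"
    (is "?L \<longleftrightarrow> ?R")
proof
  assume L: ?L
  show ?R
  proof (intro allI impI)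
    fix e :: real assume "e > 0"
    with L obtain d where d: "d > 0" "\<And>p q. dist p q < d \<Longrightarrow> dist (h p) (h q) < e"
      unfolding uniformly_continuous_on_def by (metis UNIV_I dist_commute)
    have "dist (x, y) (x', y') \<le> dist x x' + dist y y'" for x x' :: 'a and y y' :: 'b
      unfolding dist_Pair_Pair by (rule sqrt_sum_squares_le_sum) auto
    then show "\<exists>d>0. \<forall>x y x' y'. dist x x' + dist y y' < d \<longrightarrow> dist (h (x, y)) (h (x', y')) < e"
      using d by (meson le_less_trans)
  qed
next
  assume R: ?R
  show ?L
    unfolding uniformly_continuous_on_def
  proof (intro allI impI)
    fix e :: real assume "e > 0"
    with R obtain d where d: "d > 0"
      "\<And>x y x' y'. dist x x' + dist y y' < d \<Longrightarrow> dist (h (x, y)) (h (x', y')) < e"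
      by metis
    have "dist (h q) (h p) < e" if "dist q p < d / 2" for p q
      using d(2)[of "fst q" "fst p" "snd q" "snd p"] dist_fst_le[of q p] dist_snd_le[of q p] that
      by simp
    then show "\<exists>d>0. \<forall>p\<in>UNIV. \<forall>q\<in>UNIV. dist q p < d \<longrightarrow> dist (h q) (h p) < e"
      using d(1) by (intro exI[of _ "d / 2"]) auto
  qed
qed

definition AI1 ::
  "'w measure \<Rightarrow> (nat \<Rightarrow> 'w \<Rightarrow> 'a::{metric_space,second_countable_topology}) \<Rightarrow>
   (nat \<Rightarrow> 'w \<Rightarrow> 'b::{metric_space,second_countable_topology}) \<Rightarrow> bool" where
  "AI1 M X Y \<longleftrightarrow>
     (\<forall>h :: 'a \<times> 'b \<Rightarrow> real. bounded (range h) \<and> uniformly_continuous_on UNIV h \<longrightarrow>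
        (\<lambda>n. (\<integral>p. h p \<partial>(distr M borel (\<lambda>\<omega>. (X n \<omega>, Y n \<omega>)))) -
             (\<integral>p. h p \<partial>(distr M borel (X n) \<Otimes>\<^sub>M distr M borel (Y n)))) \<longlonglongrightarrow> 0)"

end

theory Submission
  imports Defs
begin

text \<open>
  Write \<open>\<Delta> n u v\<close> for the difference between the characteristic functions of the joint law of
  \<open>(X n, Y n)\<close> and of the product of its marginals, at the frequency \<open>(u, v)\<close>. For jointly Gaussian vectors,
  with \<open>U = u \<bullet> X n\<close> and \<open>V = v \<bullet> Y n\<close>, its modulus is
  \<open>exp (- (Var U + Var V) / 2) * \<bar>exp (- cov(U, V)) - 1\<bar>\<close>
  (lemma \<open>norm_char_add_diff_gaussian\<close>), and \<open>cov(U, V)\<close> is a fixed linear combination of the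
  covariances \<open>r n i j\<close>.

  If the second moments are bounded and all \<open>r n i j\<close> tend to \<open>0\<close>, then Markov's inequality gives tightness,
  and \<open>\<Delta> n u v\<close> tends to \<open>0\<close> since the first factor is at most \<open>1\<close>. For tight sequences this already
  gives asymptotic equality of the integrals of all bounded continuous functions
  (lemma \<open>tight_seq_integral_diff_tendsto_0\<close>): by the Stone-Weierstrass theorem such a function is close on a
  large compact set to a trigonometric polynomial with nearly the same global bound
  (lemma \<open>trig_poly_approx\<close>).

  Conversely, tightness of Gaussian laws bounds their second moments (lemma
  \<open>bounded_second_moment_of_tight_gaussian\<close>), so the first factor stays away from \<open>0\<close>. The cosine waves are
  bounded and Lipschitz continuous, so \<open>AI1 M X Y\<close> forces \<open>\<Delta> n u v\<close> to tend to \<open>0\<close>, hence also the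
  covariance; unit vectors \<open>u\<close> and \<open>v\<close> give \<open>r n i j\<close>.
\<close>

section \<open>Gaussian variables on the real line\<close>

text \<open>A real Gaussian variable is square integrable, and its characteristic function is determined by
  its mean and variance. The formula covers the degenerate case of variance \<open>0\<close>.\<close>

lemma (in prob_space) gaussian_real_moments:
  fixes U :: "'a \<Rightarrow> real"
  assumes U [measurable]: "U \<in> borel_measurable M"
    and G: "gaussian_real (distr M borel U)"
  shows "integrable M U"
    and "integrable M (\<lambda>\<omega>. (U \<omega>)\<^sup>2)"
    and "\<And>t. expectation (\<lambda>\<omega>. iexp (t * U \<omega>)) =
      iexp (t * expectation U) * complex_of_real (exp (- (t\<^sup>2 * variance U) / 2))"
proof -
  consider \<mu> where "distr M borel U = return borel \<mu>"
    | \<mu> \<sigma> where "\<sigma> > 0"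
        "distr M borel U = density lborel (\<lambda>x. ennreal (normal_density \<mu> \<sigma> x))"
    using G unfolding gaussian_real_def by blast
  then have "integrable M U \<and> integrable M (\<lambda>\<omega>. (U \<omega>)\<^sup>2) \<and>
    (\<forall>t. expectation (\<lambda>\<omega>. iexp (t * U \<omega>)) =
      iexp (t * expectation U) * complex_of_real (exp (- (t\<^sup>2 * variance U) / 2)))"
  proof cases
    case 1
    have "AE x in distr M borel U. x = \<mu>"
      unfolding 1 by (subst AE_return) auto
    then have ae: "AE \<omega> in M. U \<omega> = \<mu>"
      by (subst (asm) AE_distr_iff) auto
    have "integrable M U"
      using ae by (subst integrable_cong_AE[of _ _ "\<lambda>_. \<mu>"]) auto
    moreover have "integrable M (\<lambda>\<omega>. (U \<omega>)\<^sup>2)"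
      using ae by (subst integrable_cong_AE[of _ _ "\<lambda>_. \<mu>\<^sup>2"]) auto
    moreover have e: "expectation U = \<mu>"
      using ae by (subst integral_cong_AE[of _ _ "\<lambda>_. \<mu>"]) (auto simp: prob_space)
    moreover have "variance U = 0"
      unfolding e using ae by (subst integral_cong_AE[of _ _ "\<lambda>_. 0"]) auto
    moreover have "expectation (\<lambda>\<omega>. iexp (t * U \<omega>)) = iexp (t * \<mu>)" for t
      using ae by (subst integral_cong_AE[of _ _ "\<lambda>_. iexp (t * \<mu>)"]) (auto simp: prob_space)
    ultimately show ?thesis by simp
  next
    case 2
    have D: "distributed M lborel U (normal_density \<mu> \<sigma>)"
      using 2(2) unfolding distributed_def
      by (simp cong: distr_cong)
    \<comment> \<open>the standardised variable, whose characteristic function is known\<close>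
    define Z where "Z = (\<lambda>\<omega>. (U \<omega> - \<mu>) / \<sigma>)"
    have DZ: "distributed M lborel Z std_normal_density"
      using D normal_standard_normal_convert[OF 2(1)] unfolding Z_def by simp
    have [measurable]: "Z \<in> borel_measurable M" by (simp add: Z_def)
    have UZ: "U \<omega> = \<mu> + \<sigma> * Z \<omega>" for \<omega> using 2(1) by (simp add: Z_def)
    have distrZ: "distr M borel Z = std_normal_distribution"
      using distributed_distr_eq_density[OF DZ] by (simp cong: distr_cong)
    have intZ: "integrable M (\<lambda>\<omega>. Z \<omega> ^ k)" for k
      using integrable_std_normal_distribution_moment[of k]
      unfolding distrZ[symmetric] by (subst (asm) integrable_distr_eq) auto
    have intU: "integrable M U"
      unfolding UZ[abs_def] using intZ[of 1] by simp
    have intU2: "integrable M (\<lambda>\<omega>. (U \<omega>)\<^sup>2)"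
      unfolding UZ power2_sum power_mult_distrib using intZ[of 1] intZ[of 2]
      by (intro Bochner_Integration.integrable_add) (simp_all add: algebra_simps)
    have e: "expectation U = \<mu>"
      by (rule normal_distributed_expectation[OF 2(1) D])
    have v: "variance U = \<sigma>\<^sup>2"
      by (rule normal_distributed_variance[OF 2(1) D])
    have c: "expectation (\<lambda>\<omega>. iexp (s * Z \<omega>)) = complex_of_real (exp (- (s\<^sup>2) / 2))" for s
    proof -
      have "expectation (\<lambda>\<omega>. iexp (s * Z \<omega>)) = char (distr M borel Z) s"
        unfolding char_def by (subst integral_distr) auto
      also have "\<dots> = complex_of_real (exp (- (s\<^sup>2) / 2))"
        unfolding distrZ char_std_normal_distribution ..
      finally show ?thesis .
    qed
    have "expectation (\<lambda>\<omega>. iexp (t * U \<omega>)) =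
      iexp (t * \<mu>) * complex_of_real (exp (- (t\<^sup>2 * \<sigma>\<^sup>2) / 2))" for t
    proof -
      have "expectation (\<lambda>\<omega>. iexp (t * U \<omega>)) =
        expectation (\<lambda>\<omega>. iexp (t * \<mu>) * iexp ((t * \<sigma>) * Z \<omega>))"
        unfolding UZ by (simp add: exp_add[symmetric] algebra_simps)
      also have "\<dots> = iexp (t * \<mu>) * complex_of_real (exp (- ((t * \<sigma>)\<^sup>2) / 2))"
        unfolding c[symmetric] by (rule integral_mult_right_zero)
      finally show ?thesis by (simp add: power_mult_distrib)
    qed
    then show ?thesis using intU intU2 e v by simp
  qed
  then show "integrable M U" "integrable M (\<lambda>\<omega>. (U \<omega>)\<^sup>2)"
    "\<And>t. expectation (\<lambda>\<omega>. iexp (t * U \<omega>)) =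
      iexp (t * expectation U) * complex_of_real (exp (- (t\<^sup>2 * variance U) / 2))" by auto
qed

text \<open>A characteristic function is close to \<open>1\<close> at a small argument, with an error that only depends
  on how much mass lies outside \<open>[-R, R]\<close>.\<close>

lemma (in prob_space) char_near_1_of_bounded:
  fixes U :: "'a \<Rightarrow> real"
  assumes U [measurable]: "U \<in> borel_measurable M" and t: "t \<ge> 0" and R: "R \<ge> 0"
  shows "norm (expectation (\<lambda>\<omega>. iexp (t * U \<omega>)) - 1) \<le> t * R + 2 * prob {\<omega> \<in> space M. R < \<bar>U \<omega>\<bar>}"
proof -
  define A where "A = {\<omega> \<in> space M. R < \<bar>U \<omega>\<bar>}"
  have [measurable]: "A \<in> sets M" unfolding A_def by measurable
  have i: "integrable M (\<lambda>\<omega>. iexp (t * U \<omega>))"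
    by (rule integrable_const_bound[of _ 1]) auto
  have "norm (expectation (\<lambda>\<omega>. iexp (t * U \<omega>)) - 1) = norm (expectation (\<lambda>\<omega>. iexp (t * U \<omega>) - 1))"
    using i by (simp add: prob_space)
  also have "\<dots> \<le> expectation (\<lambda>\<omega>. norm (iexp (t * U \<omega>) - 1))"
    by (rule integral_norm_bound)
  also have "\<dots> \<le> expectation (\<lambda>\<omega>. t * R + 2 * indicat_real A \<omega> )"
  proof (rule integral_mono)
    show "integrable M (\<lambda>\<omega>. norm (iexp (t * U \<omega>) - 1))" using i by auto
    show "integrable M (\<lambda>\<omega>. t * R + 2 * indicat_real A \<omega>)" by (auto simp: emeasure_eq_measure)
    fix \<omega> assume w: "\<omega> \<in> space M"
    have "norm (iexp (t * U \<omega>) - 1) \<le> \<bar>t * U \<omega>\<bar>"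
      using iexp_approx1[of "t * U \<omega>" 0] by simp
    moreover have "norm (iexp (t * U \<omega>) - 1) \<le> 2"
      using norm_triangle_ineq4[of "iexp (t * U \<omega>)" 1] by simp
    moreover have "\<bar>t * U \<omega>\<bar> \<le> t * R" if "\<bar>U \<omega>\<bar> \<le> R"
      using that t by (simp add: abs_mult mult_left_mono)
    moreover have "0 \<le> t * R" using t R by simp
    ultimately show "norm (iexp (t * U \<omega>) - 1) \<le> t * R + 2 * indicat_real A \<omega>"
      using w by (auto simp: A_def indicator_def)
  qed
  also have "\<dots> = t * R + 2 * prob A"
    by (subst Bochner_Integration.integral_add) (auto simp: prob_space emeasure_eq_measure)
  finally show ?thesis unfolding A_def .
qed

text \<open>If a Gaussian variable puts mass at least \<open>7/8\<close> on \<open>[-R, R]\<close>, its second moment is at most a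
  constant times \<open>R\<^sup>2\<close>. The characteristic function at \<open>1 / (4 * R)\<close> has modulus at least \<open>1 / 2\<close>, which
  bounds the variance; Chebyshev's inequality then keeps the mean close to \<open>[-R, R]\<close>.\<close>

lemma (in prob_space) gaussian_real_second_moment_le:
  fixes U :: "'a \<Rightarrow> real"
  assumes U [measurable]: "U \<in> borel_measurable M"
    and G: "gaussian_real (distr M borel U)"
    and R: "R > 0" and p: "prob {\<omega> \<in> space M. R < \<bar>U \<omega>\<bar>} \<le> 1 / 8"
  shows "expectation (\<lambda>\<omega>. (U \<omega>)\<^sup>2) \<le> 113 * R\<^sup>2"
proof -
  note mom = gaussian_real_moments[OF U G]
  define t where "t = 1 / (4 * R)"
  have t: "t \<ge> 0" "t * R = 1 / 4" using R by (auto simp: t_def)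
  have "norm (expectation (\<lambda>\<omega>. iexp (t * U \<omega>)) - 1) \<le> 1 / 2"
    using char_near_1_of_bounded[OF U t(1), of R] R p t(2) by simp
  then have "1 / 2 \<le> norm (expectation (\<lambda>\<omega>. iexp (t * U \<omega>)))"
    using norm_triangle_ineq2[of 1 "expectation (\<lambda>\<omega>. iexp (t * U \<omega>))"]
    by (simp add: norm_minus_commute)
  then have half: "1 / 2 \<le> exp (- (t\<^sup>2 * variance U) / 2)"
    unfolding mom(3) norm_mult by simp
  have v: "variance U \<le> 32 * R\<^sup>2"
  proof (rule ccontr)
    assume "\<not> variance U \<le> 32 * R\<^sup>2"
    then have "t\<^sup>2 * variance U > t\<^sup>2 * (32 * R\<^sup>2)"
      using R by (intro mult_strict_left_mono) (auto simp: t_def)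
    also have "t\<^sup>2 * (32 * R\<^sup>2) = 32 * (t * R)\<^sup>2" by (simp add: power_mult_distrib)
    finally have "t\<^sup>2 * variance U > 2" unfolding t(2) by (simp add: power2_eq_square)
    then have "exp (- (t\<^sup>2 * variance U) / 2) < exp (- 1)" by simp
    also have "\<dots> \<le> 1 / 2"
      using exp_ge_add_one_self[of 1] by (simp add: exp_minus field_simps)
    finally show False using half by simp
  qed
  have m: "\<bar>expectation U\<bar> \<le> 9 * R"
  proof (rule ccontr)
    assume far: "\<not> \<bar>expectation U\<bar> \<le> 9 * R"
    have "prob {\<omega> \<in> space M. 8 * R \<le> \<bar>U \<omega> - expectation U\<bar>} \<le> variance U / (8 * R)\<^sup>2"
      by (rule Chebyshev_inequality) (use mom R in auto)
    also have "\<dots> \<le> 32 * R\<^sup>2 / (8 * R)\<^sup>2"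
      using v by (intro divide_right_mono) auto
    also have "\<dots> = 1 / 2" using R by (simp add: power2_eq_square)
    finally have near: "prob {\<omega> \<in> space M. 8 * R \<le> \<bar>U \<omega> - expectation U\<bar>} \<le> 1 / 2" .
    have "1 = prob (space M)" by (simp add: prob_space)
    also have "space M = {\<omega> \<in> space M. 8 * R \<le> \<bar>U \<omega> - expectation U\<bar>} \<union> {\<omega> \<in> space M. R < \<bar>U \<omega>\<bar>}"
      using far by auto
    also have "prob \<dots> \<le> prob {\<omega> \<in> space M. 8 * R \<le> \<bar>U \<omega> - expectation U\<bar>} + prob {\<omega> \<in> space M. R < \<bar>U \<omega>\<bar>}"
      by (rule measure_Un_le) auto
    finally show False using near p by simp
  qed
  \<comment> \<open>\<open>113 = 32 + 9\<^sup>2\<close>\<close>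
  have "expectation (\<lambda>\<omega>. (U \<omega>)\<^sup>2) = variance U + (expectation U)\<^sup>2"
    using variance_eq[OF mom(1,2)] by simp
  also have "(expectation U)\<^sup>2 \<le> (9 * R)\<^sup>2"
    using m power_mono[of "\<bar>expectation U\<bar>" "9 * R" 2] by simp
  finally show ?thesis using v by (simp add: power_mult_distrib)
qed

section \<open>Covariances\<close>

lemma integrable_mult_of_square_integrable:
  fixes U V :: "'a \<Rightarrow> real"
  assumes [measurable]: "U \<in> borel_measurable M" "V \<in> borel_measurable M"
    and sq: "integrable M (\<lambda>\<omega>. (U \<omega>)\<^sup>2)" "integrable M (\<lambda>\<omega>. (V \<omega>)\<^sup>2)"
  shows "integrable M (\<lambda>\<omega>. U \<omega> * V \<omega>)"
proof (rule Bochner_Integration.integrable_bound)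
  show "integrable M (\<lambda>\<omega>. (U \<omega>)\<^sup>2 + (V \<omega>)\<^sup>2)" using sq by simp
  have "\<bar>x * y\<bar> \<le> x\<^sup>2 + y\<^sup>2" for x y :: real
  proof -
    have "0 \<le> \<bar>x\<bar> * \<bar>y\<bar>" by simp
    then show ?thesis
      using sum_squares_bound[of "\<bar>x\<bar>" "\<bar>y\<bar>"] unfolding abs_mult power2_abs by linarith
  qed
  then show "AE \<omega> in M. norm (U \<omega> * V \<omega>) \<le> norm ((U \<omega>)\<^sup>2 + (V \<omega>)\<^sup>2)" by simp
qed simp

lemma (in prob_space) integrable_square_centered:
  fixes U :: "'a \<Rightarrow> real"
  assumes "integrable M U" "integrable M (\<lambda>\<omega>. (U \<omega>)\<^sup>2)"
  shows "integrable M (\<lambda>\<omega>. (U \<omega> - c)\<^sup>2)"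
  using assms by (simp add: power2_diff)

lemma (in prob_space) covariance_sum:
  fixes F :: "'i \<Rightarrow> 'a \<Rightarrow> real" and G :: "'j \<Rightarrow> 'a \<Rightarrow> real"
  assumes F: "\<And>i. F i \<in> borel_measurable M" "\<And>i. integrable M (F i)" "\<And>i. integrable M (\<lambda>\<omega>. (F i \<omega>)\<^sup>2)"
    and G: "\<And>j. G j \<in> borel_measurable M" "\<And>j. integrable M (G j)" "\<And>j. integrable M (\<lambda>\<omega>. (G j \<omega>)\<^sup>2)"
  shows "covariance M (\<lambda>\<omega>. \<Sum>i\<in>I. u i * F i \<omega>) (\<lambda>\<omega>. \<Sum>j\<in>J. v j * G j \<omega>) =
    (\<Sum>i\<in>I. \<Sum>j\<in>J. u i * v j * covariance M (F i) (G j))"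
proof -
  let ?F = "\<lambda>i \<omega>. F i \<omega> - expectation (F i)" and ?G = "\<lambda>j \<omega>. G j \<omega> - expectation (G j)"
  have int: "integrable M (\<lambda>\<omega>. ?F i \<omega> * ?G j \<omega>)" for i j
    using F G by (intro integrable_mult_of_square_integrable integrable_square_centered) auto
  have "covariance M (\<lambda>\<omega>. \<Sum>i\<in>I. u i * F i \<omega>) (\<lambda>\<omega>. \<Sum>j\<in>J. v j * G j \<omega>) =
    expectation (\<lambda>\<omega>. (\<Sum>i\<in>I. u i * ?F i \<omega>) * (\<Sum>j\<in>J. v j * ?G j \<omega>))"
    unfolding covariance_def using F(2) G(2)
    by (simp add: right_diff_distrib sum_subtractf)
  also have "\<dots> = expectation (\<lambda>\<omega>. \<Sum>i\<in>I. \<Sum>j\<in>J. u i * v j * (?F i \<omega> * ?G j \<omega>))"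
    by (simp add: sum_product mult_ac)
  also have "\<dots> = (\<Sum>i\<in>I. \<Sum>j\<in>J. u i * v j * expectation (\<lambda>\<omega>. ?F i \<omega> * ?G j \<omega>))"
    using int by (simp add: Bochner_Integration.integral_sum)
  finally show ?thesis unfolding covariance_def .
qed

text \<open>For jointly Gaussian variables the failure of the characteristic function to factorise is an
  explicit function of the covariance. Both implications of the theorem rest on this identity.\<close>

lemma (in prob_space) norm_char_add_diff_gaussian:
  fixes U V :: "'a \<Rightarrow> real"
  assumes m [measurable]: "U \<in> borel_measurable M" "V \<in> borel_measurable M"
    and G: "gaussian_real (distr M borel U)" "gaussian_real (distr M borel V)"
      "gaussian_real (distr M borel (\<lambda>\<omega>. U \<omega> + V \<omega>))"
  shows "norm (expectation (\<lambda>\<omega>. iexp (U \<omega> + V \<omega>)) - expectation (\<lambda>\<omega>. iexp (U \<omega>)) * expectation (\<lambda>\<omega>. iexp (V \<omega>)))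
    = exp (- (variance U + variance V) / 2) * \<bar>exp (- covariance M U V) - 1\<bar>"
proof -
  note U = gaussian_real_moments[OF m(1) G(1)]
  note V = gaussian_real_moments[OF m(2) G(2)]
  let ?u = "expectation U" and ?v = "expectation V"
  let ?E = "\<lambda>x. complex_of_real (exp x)"
  have "variance (\<lambda>\<omega>. U \<omega> + V \<omega>) =
    expectation (\<lambda>\<omega>. (U \<omega> - ?u)\<^sup>2 + (V \<omega> - ?v)\<^sup>2 + 2 * ((U \<omega> - ?u) * (V \<omega> - ?v)))"
    using U(1) V(1) by (intro Bochner_Integration.integral_cong) (auto simp: power2_eq_square algebra_simps)
  also have "\<dots> = variance U + variance V + 2 * covariance M U V"
  proof -
    have "integrable M (\<lambda>\<omega>. (U \<omega> - ?u)\<^sup>2)" "integrable M (\<lambda>\<omega>. (V \<omega> - ?v)\<^sup>2)"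
      using integrable_square_centered U V by auto
    moreover from this have "integrable M (\<lambda>\<omega>. (U \<omega> - ?u) * (V \<omega> - ?v))"
      by (intro integrable_mult_of_square_integrable) auto
    ultimately show ?thesis unfolding covariance_def by simp
  qed
  finally have var: "variance (\<lambda>\<omega>. U \<omega> + V \<omega>) = variance U + variance V + 2 * covariance M U V" .
  have UV: "expectation (\<lambda>\<omega>. iexp (U \<omega> + V \<omega>)) =
    iexp (?u + ?v) * ?E (- (variance U + variance V + 2 * covariance M U V) / 2)"
    unfolding var[symmetric] using gaussian_real_moments(3)[OF _ G(3), of 1] U(1) V(1) by simp
  have "- (variance U + variance V + 2 * covariance M U V) / 2 =
    - (variance U + variance V) / 2 + (- covariance M U V)" by (simp add: field_simps)
  then have "expectation (\<lambda>\<omega>. iexp (U \<omega> + V \<omega>)) =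
    iexp (?u + ?v) * (?E (- (variance U + variance V) / 2) * ?E (- covariance M U V))"
    unfolding UV by (simp only: exp_add of_real_mult)
  moreover have "expectation (\<lambda>\<omega>. iexp (U \<omega>)) * expectation (\<lambda>\<omega>. iexp (V \<omega>)) =
    iexp (?u + ?v) * ?E (- (variance U + variance V) / 2)"
  proof -
    have "- (variance U + variance V) / 2 = - variance U / 2 + - variance V / 2" by simp
    then show ?thesis
      using U(3)[of 1] V(3)[of 1] by (simp only: exp_add of_real_mult of_real_add distrib_left) simp
  qed
  ultimately have "expectation (\<lambda>\<omega>. iexp (U \<omega> + V \<omega>)) - expectation (\<lambda>\<omega>. iexp (U \<omega>)) * expectation (\<lambda>\<omega>. iexp (V \<omega>)) =
    iexp (?u + ?v) * (?E (- (variance U + variance V) / 2) * complex_of_real (exp (- covariance M U V) - 1))"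
    by (simp add: right_diff_distrib)
  then show ?thesis
    by (simp only: norm_mult norm_exp_i_times norm_of_real) simp
qed

section \<open>Trigonometric polynomials\<close>

text \<open>Real trigonometric polynomials on a Euclidean space, with arbitrary real frequencies: the finite sums
  of cosine waves \<open>w * cos (l \<bullet> z + c)\<close>. The phase \<open>c\<close> makes separate sine terms unnecessary.\<close>

inductive trig_poly :: "('a::euclidean_space \<Rightarrow> real) \<Rightarrow> bool" where
  cosine: "trig_poly (\<lambda>z. w * cos (l \<bullet> z + c))"
| add: "trig_poly f \<Longrightarrow> trig_poly g \<Longrightarrow> trig_poly (\<lambda>z. f z + g z)"

lemma trig_poly_const: "trig_poly (\<lambda>z. w)"
  using trig_poly.cosine[of w 0 0] by simp

lemma trig_poly_sum:
  assumes "\<And>i. i \<in> I \<Longrightarrow> trig_poly (f i)"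
  shows "trig_poly (\<lambda>z. \<Sum>i\<in>I. f i z)"
  using assms
  by (induction I rule: infinite_finite_induct) (auto intro: trig_poly_const trig_poly.add)

lemma trig_poly_mult:
  assumes "trig_poly f" "trig_poly g"
  shows "trig_poly (\<lambda>z. f z * g z)"
  using assms(1)
proof induction
  case (cosine w l c)
  show ?case using assms(2)
  proof induction
    case (cosine w' l' c')
    have "(\<lambda>z. w * cos (l \<bullet> z + c) * (w' * cos (l' \<bullet> z + c'))) =
      (\<lambda>z. w * w' / 2 * cos ((l - l') \<bullet> z + (c - c')) + w * w' / 2 * cos ((l + l') \<bullet> z + (c + c')))"
    proof
      fix z
      have "w * cos (l \<bullet> z + c) * (w' * cos (l' \<bullet> z + c')) =
        w * w' * (cos (l \<bullet> z + c) * cos (l' \<bullet> z + c'))" by simp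
      also have "\<dots> = w * w' * ((cos ((l \<bullet> z + c) - (l' \<bullet> z + c')) + cos ((l \<bullet> z + c) + (l' \<bullet> z + c'))) / 2)"
        by (simp only: cos_times_cos)
      also have "(l \<bullet> z + c) - (l' \<bullet> z + c') = (l - l') \<bullet> z + (c - c')"
        by (simp add: inner_diff_left)
      also have "(l \<bullet> z + c) + (l' \<bullet> z + c') = (l + l') \<bullet> z + (c + c')"
        by (simp add: inner_add_left)
      finally show "w * cos (l \<bullet> z + c) * (w' * cos (l' \<bullet> z + c')) =
        w * w' / 2 * cos ((l - l') \<bullet> z + (c - c')) + w * w' / 2 * cos ((l + l') \<bullet> z + (c + c'))"
        by (simp add: field_simps)
    qed
    then show ?case by (simp only:) (intro trig_poly.intros)
  next
    case (add f g)
    then show ?case by (simp add: distrib_left trig_poly.add)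
  qed
next
  case (add f g)
  then show ?case by (simp add: distrib_right trig_poly.add)
qed

lemma trig_poly_continuous: "trig_poly f \<Longrightarrow> continuous_on UNIV f"
  by (induction rule: trig_poly.induct) (auto intro!: continuous_intros)

lemma trig_poly_bounded: "trig_poly f \<Longrightarrow> \<exists>B. \<forall>z. \<bar>f z\<bar> \<le> B"
proof (induction rule: trig_poly.induct)
  case (cosine w l c)
  have "\<bar>w * cos (l \<bullet> z + c)\<bar> \<le> \<bar>w\<bar>" for z
    by (simp add: abs_mult mult_left_le)
  then show ?case by blast
next
  case (add f g)
  then obtain B C where "\<And>z. \<bar>f z\<bar> \<le> B" "\<And>z. \<bar>g z\<bar> \<le> C" by blast
  then have "\<bar>f z + g z\<bar> \<le> B + C" for z
    by (meson abs_triangle_ineq add_mono order_trans)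
  then show ?case by blast
qed

lemma trig_poly_polynomial_sin:
  fixes p :: "'a::euclidean_space \<Rightarrow> real"
  assumes "real_polynomial_function p"
  shows "trig_poly (\<lambda>z::'a. p (\<Sum>b\<in>Basis. sin ((z \<bullet> b) / L) *\<^sub>R b))"
  using assms
proof induction
  case (linear p)
  interpret bounded_linear p by fact
  \<comment> \<open>sine as a cosine wave with phase \<open>- pi / 2\<close>\<close>
  have "(\<lambda>z::'a. p b * sin ((z \<bullet> b) / L)) =
    (\<lambda>z. p b * cos ((b /\<^sub>R L) \<bullet> z + (- pi / 2)))" for b
  proof
    fix z :: 'a
    have "(b /\<^sub>R L) \<bullet> z = (z \<bullet> b) / L"
      by (simp add: inner_commute[of b z] field_simps)
    moreover have "cos (x + (- pi / 2)) = sin x" for x :: real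
      by (simp add: cos_diff)
    ultimately show "p b * sin ((z \<bullet> b) / L) = p b * cos ((b /\<^sub>R L) \<bullet> z + (- pi / 2))"
      by (simp only:)
  qed
  then have "trig_poly (\<lambda>z::'a. p b * sin ((z \<bullet> b) / L))" for b
    by (simp only: trig_poly.cosine)
  then have "trig_poly (\<lambda>z::'a. \<Sum>b\<in>Basis. p b * sin ((z \<bullet> b) / L))"
    by (rule trig_poly_sum)
  also have "(\<lambda>z::'a. \<Sum>b\<in>Basis. p b * sin ((z \<bullet> b) / L)) =
    (\<lambda>z. p (\<Sum>b\<in>Basis. sin ((z \<bullet> b) / L) *\<^sub>R b))"
    by (simp only: sum scaleR real_scaleR_def mult.commute)
  finally show ?case .
qed (auto intro: trig_poly_const trig_poly_mult trig_poly.add)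

text \<open>A bounded continuous function can be approximated uniformly on a compact set by a trigonometric
  polynomial that exceeds the bound of the function by at most \<open>e\<close> \<^emph>\<open>everywhere\<close>. The map \<open>S\<close> that applies
  \<open>sin (_ / L)\<close> to each coordinate sends the whole space into a cube and is inverted on \<open>K\<close> by
  \<open>L * arcsin _\<close>. Hence \<open>h = G \<circ> S\<close> on \<open>K\<close> for a continuous function \<open>G\<close> on the cube with the same bound
  as \<open>h\<close>, and a polynomial approximation \<open>p\<close> of \<open>G\<close> on the cube yields \<open>p \<circ> S\<close>.\<close>

lemma trig_poly_approx:
  fixes h :: "'a::euclidean_space \<Rightarrow> real"
  assumes "compact K" and h: "continuous_on UNIV h" "\<And>z. \<bar>h z\<bar> \<le> B" and "e > 0"
  obtains T where "trig_poly T" "\<And>z. \<bar>T z\<bar> \<le> B + e" "\<And>z. z \<in> K \<Longrightarrow> \<bar>h z - T z\<bar> \<le> e"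
proof -
  obtain L where L: "L > 0" "\<And>z. z \<in> K \<Longrightarrow> norm z \<le> L"
    using compact_imp_bounded[OF \<open>compact K\<close>] unfolding bounded_pos by auto
  define G where "G = (\<lambda>s::'a. h (\<Sum>b\<in>Basis. (L * arcsin (s \<bullet> b)) *\<^sub>R b))"
  define S where "S = (\<lambda>z::'a. \<Sum>b\<in>Basis. sin ((z \<bullet> b) / L) *\<^sub>R b)"
  have "continuous_on (cbox (- One) One) G"
    unfolding G_def
    by (intro continuous_on_compose2[OF h(1)] continuous_intros)
       (auto simp: mem_box)
  then obtain p where p: "real_polynomial_function p"
    "\<And>s. s \<in> cbox (- One) One \<Longrightarrow> \<bar>G s - p s\<bar> < e"
    using Stone_Weierstrass_real_polynomial_function[OF compact_cbox _ \<open>e > 0\<close>] by metis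
  have S: "S z \<in> cbox (- One) One" for z
    by (auto simp: mem_box S_def)
  have GS: "G (S z) = h z" if "z \<in> K" for z
  proof -
    have "L * arcsin (S z \<bullet> b) = z \<bullet> b" if b: "b \<in> Basis" for b
    proof -
      have "\<bar>z \<bullet> b\<bar> \<le> L"
        using Basis_le_norm[OF b, of z] L(2)[OF \<open>z \<in> K\<close>] by linarith
      then have "\<bar>(z \<bullet> b) / L\<bar> \<le> 1" using L(1) by simp
      then have "- (pi / 2) \<le> (z \<bullet> b) / L" "(z \<bullet> b) / L \<le> pi / 2"
        using pi_gt3 by linarith+
      then have "arcsin (sin ((z \<bullet> b) / L)) = (z \<bullet> b) / L" by (rule arcsin_sin)
      then show ?thesis using L(1) b by (simp add: S_def)
    qed
    then show ?thesis unfolding G_def by (simp add: euclidean_representation)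
  qed
  show ?thesis
  proof
    show "trig_poly (\<lambda>z. p (S z))"
      unfolding S_def by (rule trig_poly_polynomial_sin[OF p(1)])
    show "\<bar>p (S z)\<bar> \<le> B + e" for z
      using p(2)[OF S[of z]] h(2)[of "\<Sum>b\<in>Basis. (L * arcsin (S z \<bullet> b)) *\<^sub>R b"]
      unfolding G_def by linarith
    show "\<bar>h z - p (S z)\<bar> \<le> e" if "z \<in> K" for z
      using p(2)[OF S[of z]] GS[OF that] by simp
  qed
qed

section \<open>Asymptotically equal integrals from characteristic functions\<close>

lemma integrable_bounded_continuous:
  fixes h :: "'a::euclidean_space \<Rightarrow> real"
  assumes "prob_space P" and s: "sets P = sets borel"
    and h: "continuous_on UNIV h" "\<And>z. \<bar>h z\<bar> \<le> B"
  shows "integrable P h"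
proof -
  interpret prob_space P by fact
  have "h \<in> borel_measurable P"
    using borel_measurable_continuous_onI[OF h(1)] measurable_cong_sets[OF s refl] by blast
  then show ?thesis
    by (intro integrable_const_bound[of _ B]) (use h(2) in auto)
qed

lemma integral_diff_le_compact:
  fixes f g :: "'a::euclidean_space \<Rightarrow> real"
  assumes P: "prob_space P" "sets P = sets borel"
    and f: "continuous_on UNIV f" "\<And>z. \<bar>f z\<bar> \<le> B"
    and g: "continuous_on UNIV g" "\<And>z. \<bar>g z\<bar> \<le> C"
    and K: "compact K" "\<And>z. z \<in> K \<Longrightarrow> \<bar>f z - g z\<bar> \<le> e" and e: "e \<ge> 0"
  shows "\<bar>(\<integral>z. f z \<partial>P) - (\<integral>z. g z \<partial>P)\<bar> \<le> e + (B + C) * measure P (- K)"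
proof -
  interpret prob_space P by fact
  have m: "- K \<in> sets P"
    using K(1) P(2) by (simp add: compact_imp_closed borel_open open_Compl)
  have i: "integrable P f" "integrable P g"
    using integrable_bounded_continuous[OF P] f g by blast+
  have "\<bar>(\<integral>z. f z \<partial>P) - (\<integral>z. g z \<partial>P)\<bar> = \<bar>\<integral>z. f z - g z \<partial>P\<bar>"
    using i by simp
  also have "\<dots> \<le> (\<integral>z. \<bar>f z - g z\<bar> \<partial>P)"
    by (rule integral_abs_bound)
  also have "\<dots> \<le> (\<integral>z. e + (B + C) * indicat_real (- K) z \<partial>P)"
  proof (rule integral_mono)
    show "integrable P (\<lambda>z. \<bar>f z - g z\<bar>)" using i by auto
    show "integrable P (\<lambda>z. e + (B + C) * indicat_real (- K) z)"
      using m by (auto simp: emeasure_eq_measure)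
    show "\<bar>f z - g z\<bar> \<le> e + (B + C) * indicat_real (- K) z" for z
      using f(2)[of z] g(2)[of z] K(2)[of z] e by (auto simp: indicator_def)
  qed
  also have "\<dots> = e + (B + C) * measure P (- K)"
    using m by (subst Bochner_Integration.integral_add) (auto simp: emeasure_eq_measure prob_space)
  finally show ?thesis .
qed

text \<open>Two tight sequences whose integrals of every cosine wave are asymptotically equal, that is, whose
  characteristic functions are pointwise asymptotically equal, have asymptotically equal integrals of
  every bounded continuous function. No limit law is needed.\<close>

lemma tight_seq_integral_diff_tendsto_0:
  fixes P Q :: "nat \<Rightarrow> 'a::euclidean_space measure"
  assumes P: "\<And>n. prob_space (P n)" "\<And>n. sets (P n) = sets borel" "tight_seq P"
    and Q: "\<And>n. prob_space (Q n)" "\<And>n. sets (Q n) = sets borel" "tight_seq Q"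
    and cos: "\<And>l c. (\<lambda>n. (\<integral>z. cos (l \<bullet> z + c) \<partial>P n) - (\<integral>z. cos (l \<bullet> z + c) \<partial>Q n)) \<longlonglongrightarrow> 0"
    and h: "continuous_on UNIV h" "bounded (range h)"
  shows "(\<lambda>n. (\<integral>z. h z \<partial>P n) - (\<integral>z. h z \<partial>Q n)) \<longlonglongrightarrow> (0::real)"
proof -
  have trig: "(\<lambda>n. (\<integral>z. T z \<partial>P n) - (\<integral>z. T z \<partial>Q n)) \<longlonglongrightarrow> 0" if "trig_poly T" for T
    using that
  proof induction
    case (cosine w l c)
    show ?case
      using tendsto_mult_left[OF cos[of l c], of w] by (simp add: right_diff_distrib)
  next
    case (add f g)
    have "integrable (R n) f \<and> integrable (R n) g"
      if "\<And>n. prob_space (R n)" "\<And>n. sets (R n) = sets borel" for R n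
      using integrable_bounded_continuous[OF that] add.hyps trig_poly_continuous trig_poly_bounded
      by metis
    from this[OF P(1,2), of "\<lambda>n. n"] this[OF Q(1,2), of "\<lambda>n. n"] tendsto_add[OF add.IH]
    show ?case by (simp add: algebra_simps)
  qed
  obtain B where B: "\<And>z. \<bar>h z\<bar> \<le> B" "B > 0"
    using h(2) unfolding bounded_pos by auto
  show ?thesis
  proof (rule LIMSEQ_I)
    fix \<epsilon> :: real assume "\<epsilon> > 0"
    \<comment> \<open>replacing \<open>h\<close> by \<open>T\<close> will cost \<open>2 * e\<close> for each measure, and the difference for \<open>T\<close> at most \<open>e\<close>;
      \<open>e \<le> B\<close> bounds \<open>\<bar>h - T\<bar>\<close> by \<open>3 * B\<close> outside the compact set\<close>
    define e where "e = min B (\<epsilon> / 5)"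
    have e: "e > 0" "e \<le> B" "5 * e \<le> \<epsilon>" using \<open>\<epsilon> > 0\<close> B(2) by (auto simp: e_def)
    define d where "d = e / (3 * B)"
    have d: "d > 0" using e B by (simp add: d_def)
    obtain K1 where K1: "compact K1" "\<And>n. measure (P n) (- K1) < d"
      using P(3) d unfolding tight_seq_def by meson
    obtain K2 where K2: "compact K2" "\<And>n. measure (Q n) (- K2) < d"
      using Q(3) d unfolding tight_seq_def by meson
    obtain T where T: "trig_poly T" "\<And>z. \<bar>T z\<bar> \<le> B + e"
      "\<And>z. z \<in> K1 \<union> K2 \<Longrightarrow> \<bar>h z - T z\<bar> \<le> e"
      using trig_poly_approx[OF compact_Un[OF K1(1) K2(1)] h(1) B(1) e(1)] by metis
    have *: "\<bar>(\<integral>z. h z \<partial>R) - (\<integral>z. T z \<partial>R)\<bar> < 2 * e"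
      if "prob_space R" "sets R = sets borel" "compact K" "K \<subseteq> K1 \<union> K2" "measure R (- K) < d" for R K
    proof -
      have "\<bar>(\<integral>z. h z \<partial>R) - (\<integral>z. T z \<partial>R)\<bar> \<le> e + (B + (B + e)) * measure R (- K)"
        by (rule integral_diff_le_compact[OF that(1,2) h(1) B(1) trig_poly_continuous[OF T(1)] T(2) that(3)])
          (use T(3) that(4) e in auto)
      also have "\<dots> \<le> e + (3 * B) * measure R (- K)"
        using e by (intro add_left_mono mult_right_mono) auto
      also have "\<dots> < e + (3 * B) * d"
        using that(5) B(2) by (intro add_strict_left_mono mult_strict_left_mono) auto
      also have "\<dots> = 2 * e" using B(2) by (simp add: d_def)
      finally show ?thesis .
    qed
    obtain N where N: "\<And>n. n \<ge> N \<Longrightarrow> \<bar>(\<integral>z. T z \<partial>P n) - (\<integral>z. T z \<partial>Q n)\<bar> < e"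
      using LIMSEQ_D[OF trig[OF T(1)] e(1)] by auto
    have "\<bar>(\<integral>z. h z \<partial>P n) - (\<integral>z. h z \<partial>Q n)\<bar> < \<epsilon>" if "n \<ge> N" for n
      using N[OF that] *[OF P(1,2) K1(1) _ K1(2), of n] *[OF Q(1,2) K2(1) _ K2(2), of n] e(3)
      unfolding abs_less_iff by auto
    then show "\<exists>N. \<forall>n\<ge>N. norm ((\<integral>z. h z \<partial>P n) - (\<integral>z. h z \<partial>Q n) - 0) < \<epsilon>" by auto
  qed
qed

section \<open>Joint laws and products of marginals\<close>

text \<open>Any coupling of two tight sequences is tight. This is needed for the joint laws and also for the
  products of the marginals.\<close>

lemma tight_seq_prod:
  fixes J :: "nat \<Rightarrow> ('a::euclidean_space \<times> 'b::euclidean_space) measure"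
  assumes J: "\<And>n. prob_space (J n)" "\<And>n. sets (J n) = sets borel"
    and tight: "tight_seq (\<lambda>n. distr (J n) borel fst)" "tight_seq (\<lambda>n. distr (J n) borel snd)"
  shows "tight_seq J"
  unfolding tight_seq_def
proof (intro allI impI)
  fix \<epsilon> :: real assume "\<epsilon> > 0"
  then have "\<epsilon> / 2 > 0" by simp
  obtain K1 where K1: "compact K1" "\<And>n. measure (distr (J n) borel fst) (- K1) < \<epsilon> / 2"
    using tight(1) \<open>\<epsilon> / 2 > 0\<close> unfolding tight_seq_def by meson
  obtain K2 where K2: "compact K2" "\<And>n. measure (distr (J n) borel snd) (- K2) < \<epsilon> / 2"
    using tight(2) \<open>\<epsilon> / 2 > 0\<close> unfolding tight_seq_def by meson
  have "measure (J n) (- (K1 \<times> K2)) < \<epsilon>" for n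
  proof -
    interpret prob_space "J n" by (rule J)
    have sp: "space (J n) = UNIV" using sets_eq_imp_space_eq[OF J(2)] by simp
    have m1: "fst \<in> borel_measurable (J n)" and m2: "snd \<in> borel_measurable (J n)"
      unfolding measurable_cong_sets[OF J(2) refl]
      by (intro borel_measurable_continuous_onI continuous_intros)+
    have b: "- K1 \<in> sets borel" "- K2 \<in> sets borel"
      using K1(1) K2(1) by (simp_all add: compact_imp_closed borel_open open_Compl)
    have "measure (J n) (- (K1 \<times> K2)) = measure (J n) (fst -` (- K1) \<union> snd -` (- K2))"
      by (rule arg_cong[where f = "measure (J n)"]) auto
    also have "\<dots> \<le> measure (J n) (fst -` (- K1)) + measure (J n) (snd -` (- K2))"
      using measurable_sets[OF m1 b(1)] measurable_sets[OF m2 b(2)] sp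
      by (intro measure_Un_le) auto
    also have "\<dots> = measure (distr (J n) borel fst) (- K1) + measure (distr (J n) borel snd) (- K2)"
      using m1 m2 b sp by (simp add: measure_distr)
    also have "\<dots> < \<epsilon>" using K1(2)[of n] K2(2)[of n] by linarith
    finally show ?thesis .
  qed
  then show "\<exists>K. compact K \<and> (\<forall>n. measure (J n) (- K) < \<epsilon>)"
    using compact_Times[OF K1(1) K2(1)] by blast
qed

lemma distr_pair_measure_snd:
  assumes "prob_space A" "prob_space B"
  shows "distr (A \<Otimes>\<^sub>M B) B snd = B"
proof (rule measure_eqI)
  interpret A: prob_space A by fact
  interpret B: prob_space B by fact
  fix C assume "C \<in> sets (distr (A \<Otimes>\<^sub>M B) B snd)"
  then have C: "C \<in> sets B" by simp
  have "snd -` C \<inter> space (A \<Otimes>\<^sub>M B) = space A \<times> C"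
    using sets.sets_into_space[OF C] by (auto simp: space_pair_measure)
  then have "emeasure (distr (A \<Otimes>\<^sub>M B) B snd) C = emeasure (A \<Otimes>\<^sub>M B) (space A \<times> C)"
    using C by (simp add: emeasure_distr)
  also have "\<dots> = emeasure B C"
    using C by (simp add: B.emeasure_pair_measure_Times A.emeasure_space_1)
  finally show "emeasure (distr (A \<Otimes>\<^sub>M B) B snd) C = emeasure B C" .
qed simp

lemma integral_pair_measure_mult:
  fixes f :: "'a \<Rightarrow> complex" and g :: "'b \<Rightarrow> complex"
  assumes "prob_space A" "prob_space B"
    and f: "f \<in> borel_measurable A" "\<And>x. norm (f x) \<le> 1"
    and g: "g \<in> borel_measurable B" "\<And>y. norm (g y) \<le> 1"
  shows "(\<integral>p. f (fst p) * g (snd p) \<partial>(A \<Otimes>\<^sub>M B)) = (\<integral>x. f x \<partial>A) * (\<integral>y. g y \<partial>B)"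
proof -
  interpret A: prob_space A by fact
  interpret B: prob_space B by fact
  interpret pair_prob_space A B ..
  note [measurable] = f(1) g(1)
  have "norm (f x * g y) \<le> 1" for x y
    using f(2)[of x] g(2)[of y] by (simp add: norm_mult mult_le_one)
  then have "integrable (A \<Otimes>\<^sub>M B) (\<lambda>p. f (fst p) * g (snd p))"
    by (intro integrable_const_bound[of _ 1]) auto
  from integral_fst'[OF this] show ?thesis by simp
qed

text \<open>On a cosine wave, the difference between the joint law and the product of the marginals is the real
  part of a rotated difference of characteristic functions.\<close>

lemma (in prob_space) integral_cos_joint_minus_product:
  fixes X :: "'a \<Rightarrow> 'b::euclidean_space" and Y :: "'a \<Rightarrow> 'c::euclidean_space"
  assumes [measurable]: "X \<in> borel_measurable M" "Y \<in> borel_measurable M"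
  shows "(\<integral>p. cos ((u, v) \<bullet> p + c) \<partial>distr M borel (\<lambda>\<omega>. (X \<omega>, Y \<omega>))) -
      (\<integral>p. cos ((u, v) \<bullet> p + c) \<partial>(distr M borel X \<Otimes>\<^sub>M distr M borel Y)) =
    Re (cis c * (expectation (\<lambda>\<omega>. iexp (u \<bullet> X \<omega> + v \<bullet> Y \<omega>)) -
      expectation (\<lambda>\<omega>. iexp (u \<bullet> X \<omega>)) * expectation (\<lambda>\<omega>. iexp (v \<bullet> Y \<omega>))))"
proof -
  have cos_eq: "cos (x + c) = Re (cis c * iexp x)" for x
    by (simp add: cis_conv_exp exp_add[symmetric] Re_exp add.commute)
  interpret A: prob_space "distr M borel X" by (rule prob_space_distr) simp
  interpret B: prob_space "distr M borel Y" by (rule prob_space_distr) simp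
  interpret AB: pair_prob_space "distr M borel X" "distr M borel Y" ..
  have "(\<integral>p. cos ((u, v) \<bullet> p + c) \<partial>distr M borel (\<lambda>\<omega>. (X \<omega>, Y \<omega>))) =
      expectation (\<lambda>\<omega>. Re (cis c * iexp (u \<bullet> X \<omega> + v \<bullet> Y \<omega>)))"
    by (subst integral_distr) (auto simp: cos_eq)
  also have "\<dots> = Re (cis c * expectation (\<lambda>\<omega>. iexp (u \<bullet> X \<omega> + v \<bullet> Y \<omega>)))"
    by (subst integral_Re) (auto intro!: integrable_mult_right integrable_const_bound[of _ 1])
  finally have 1: "(\<integral>p. cos ((u, v) \<bullet> p + c) \<partial>distr M borel (\<lambda>\<omega>. (X \<omega>, Y \<omega>))) =
    Re (cis c * expectation (\<lambda>\<omega>. iexp (u \<bullet> X \<omega> + v \<bullet> Y \<omega>)))" .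
  have "(\<integral>p. cos ((u, v) \<bullet> p + c) \<partial>(distr M borel X \<Otimes>\<^sub>M distr M borel Y)) =
      (\<integral>p. Re (cis c * (iexp (u \<bullet> fst p) * iexp (v \<bullet> snd p))) \<partial>(distr M borel X \<Otimes>\<^sub>M distr M borel Y))"
    unfolding cos_eq
    by (intro Bochner_Integration.integral_cong refl)
       (simp add: inner_prod_def exp_add distrib_left)
  also have "\<dots> = Re (cis c * (\<integral>p. iexp (u \<bullet> fst p) * iexp (v \<bullet> snd p) \<partial>(distr M borel X \<Otimes>\<^sub>M distr M borel Y)))"
    by (subst integral_Re) (auto intro!: integrable_mult_right AB.integrable_const_bound[of _ 1] simp: norm_mult)
  also have "(\<integral>p. iexp (u \<bullet> fst p) * iexp (v \<bullet> snd p) \<partial>(distr M borel X \<Otimes>\<^sub>M distr M borel Y)) =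
      (\<integral>x. iexp (u \<bullet> x) \<partial>distr M borel X) * (\<integral>y. iexp (v \<bullet> y) \<partial>distr M borel Y)"
    by (rule integral_pair_measure_mult) (auto intro: A.prob_space_axioms B.prob_space_axioms)
  also have "\<dots> = expectation (\<lambda>\<omega>. iexp (u \<bullet> X \<omega>)) * expectation (\<lambda>\<omega>. iexp (v \<bullet> Y \<omega>))"
    by (subst (1 2) integral_distr) auto
  finally show ?thesis using 1 by (simp add: right_diff_distrib)
qed

section \<open>Gaussian vectors, tightness and second moments\<close>

lemma (in prob_space) gaussian_pair_linear:
  fixes X :: "'a \<Rightarrow> 'b::euclidean_space" and Y :: "'a \<Rightarrow> 'c::euclidean_space"
  assumes [measurable]: "X \<in> borel_measurable M" "Y \<in> borel_measurable M"
    and G: "gaussian (distr M borel (\<lambda>\<omega>. (X \<omega>, Y \<omega>)))"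
  shows "gaussian_real (distr M borel (\<lambda>\<omega>. u \<bullet> X \<omega> + v \<bullet> Y \<omega>))"
proof -
  let ?f = "\<lambda>p :: 'b \<times> 'c. (u, v) \<bullet> p"
  have "linear ?f" by (intro bounded_linear.linear bounded_linear_inner_right)
  then have "gaussian_real (distr (distr M borel (\<lambda>\<omega>. (X \<omega>, Y \<omega>))) borel ?f)"
    using G unfolding gaussian_def by blast
  also have "distr (distr M borel (\<lambda>\<omega>. (X \<omega>, Y \<omega>))) borel ?f = distr M borel (\<lambda>\<omega>. u \<bullet> X \<omega> + v \<bullet> Y \<omega>)"
    by (subst distr_distr) (auto simp: comp_def)
  finally show ?thesis .
qed

lemma (in prob_space) gaussian_vector_second_moment:
  fixes X :: "'a \<Rightarrow> 'b::euclidean_space"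
  assumes [measurable]: "X \<in> borel_measurable M"
    and G: "\<And>u. gaussian_real (distr M borel (\<lambda>\<omega>. u \<bullet> X \<omega>))"
  shows "integrable M (\<lambda>\<omega>. (norm (X \<omega>))\<^sup>2)"
    and "expectation (\<lambda>\<omega>. (norm (X \<omega>))\<^sup>2) = (\<Sum>b\<in>Basis. expectation (\<lambda>\<omega>. (b \<bullet> X \<omega>)\<^sup>2))"
proof -
  have i: "integrable M (\<lambda>\<omega>. (b \<bullet> X \<omega>)\<^sup>2)" for b
    by (rule gaussian_real_moments(2)[OF _ G]) simp
  have n: "(norm x)\<^sup>2 = (\<Sum>b\<in>Basis. (b \<bullet> x)\<^sup>2)" for x :: 'b
    unfolding power2_norm_eq_inner
    by (subst euclidean_inner) (simp only: power2_eq_square inner_commute)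
  show "integrable M (\<lambda>\<omega>. (norm (X \<omega>))\<^sup>2)"
    unfolding n using i by simp
  show "expectation (\<lambda>\<omega>. (norm (X \<omega>))\<^sup>2) = (\<Sum>b\<in>Basis. expectation (\<lambda>\<omega>. (b \<bullet> X \<omega>)\<^sup>2))"
    unfolding n using i by (simp add: Bochner_Integration.integral_sum)
qed

lemma (in prob_space) tight_seq_second_moment:
  fixes X :: "nat \<Rightarrow> 'a \<Rightarrow> 'b::euclidean_space"
  assumes X [measurable]: "\<And>n. X n \<in> borel_measurable M"
    and int: "\<And>n. integrable M (\<lambda>\<omega>. (norm (X n \<omega>))\<^sup>2)"
    and bdd: "bounded (range (\<lambda>n. \<integral>\<omega>. (norm (X n \<omega>))\<^sup>2 \<partial>M))"
  shows "tight_seq (\<lambda>n. distr M borel (X n))"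
  unfolding tight_seq_def
proof (intro allI impI)
  fix \<epsilon> :: real assume \<epsilon>: "\<epsilon> > 0"
  obtain C where C: "C > 0" "\<And>n. \<bar>\<integral>\<omega>. (norm (X n \<omega>))\<^sup>2 \<partial>M\<bar> \<le> C"
    using bdd unfolding bounded_pos by auto
  define R where "R = sqrt (2 * C / \<epsilon>)"
  have R: "R > 0" "R\<^sup>2 = 2 * C / \<epsilon>" using C(1) \<epsilon> by (auto simp: R_def)
  have "measure (distr M borel (X n)) (- cball 0 R) < \<epsilon>" for n
  proof -
    have "measure (distr M borel (X n)) (- cball 0 R) = prob (X n -` (- cball 0 R) \<inter> space M)"
      by (rule measure_distr) auto
    also have "\<dots> \<le> prob {\<omega> \<in> space M. R\<^sup>2 \<le> (norm (X n \<omega>))\<^sup>2}"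
      using R(1) by (intro finite_measure_mono) (auto intro: power_mono)
    \<comment> \<open>the set \<open>A\<close> does not occur in the inequality itself\<close>
    also have "\<dots> \<le> (\<integral>\<omega>. (norm (X n \<omega>))\<^sup>2 \<partial>M) / R\<^sup>2"
      using R(1) by (intro integral_Markov_inequality_measure[OF int, where A = "{}"]) auto
    also have "\<dots> \<le> C / R\<^sup>2"
      using C(2)[of n] by (intro divide_right_mono) auto
    also have "\<dots> = \<epsilon> / 2" unfolding R(2) using C(1) \<epsilon> by (simp add: field_simps)
    also have "\<dots> < \<epsilon>" using \<epsilon> by simp
    finally show ?thesis .
  qed
  then show "\<exists>K. compact K \<and> (\<forall>n. measure (distr M borel (X n)) (- K) < \<epsilon>)"
    by (intro exI[of _ "cball 0 R"]) auto
qed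

lemma (in prob_space) bounded_second_moment_of_tight_gaussian:
  fixes X :: "nat \<Rightarrow> 'a \<Rightarrow> 'b::euclidean_space"
  assumes X [measurable]: "\<And>n. X n \<in> borel_measurable M"
    and G: "\<And>n u. gaussian_real (distr M borel (\<lambda>\<omega>. u \<bullet> X n \<omega>))"
    and tight: "tight_seq (\<lambda>n. distr M borel (X n))"
  shows "bounded (range (\<lambda>n. \<integral>\<omega>. (norm (X n \<omega>))\<^sup>2 \<partial>M))"
proof -
  have "(1/8 :: real) > 0" by simp
  then obtain K where K: "compact K" "\<And>n. measure (distr M borel (X n)) (- K) < 1 / 8"
    using tight unfolding tight_seq_def by meson
  obtain R where R: "R > 0" "\<And>x. x \<in> K \<Longrightarrow> norm x \<le> R"
    using compact_imp_bounded[OF K(1)] unfolding bounded_pos by auto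
  have comp: "expectation (\<lambda>\<omega>. (b \<bullet> X n \<omega>)\<^sup>2) \<le> 113 * R\<^sup>2" if b: "b \<in> Basis" for b n
  proof (rule gaussian_real_second_moment_le[OF _ G R(1)])
    have "- K \<in> sets borel" using K(1) by (simp add: compact_imp_closed borel_open open_Compl)
    have outside: "x \<notin> K" if "R < \<bar>b \<bullet> x\<bar>" for x
      using Basis_le_norm[OF b, of x] R(2)[of x] that by (auto simp: inner_commute)
    have "{\<omega> \<in> space M. R < \<bar>b \<bullet> X n \<omega>\<bar>} \<subseteq> X n -` (- K) \<inter> space M"
      using outside by auto
    then have "prob {\<omega> \<in> space M. R < \<bar>b \<bullet> X n \<omega>\<bar>} \<le> prob (X n -` (- K) \<inter> space M)"
      by (rule finite_measure_mono[OF _ measurable_sets[OF X \<open>- K \<in> sets borel\<close>]])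
    also have "\<dots> = measure (distr M borel (X n)) (- K)"
      using \<open>- K \<in> sets borel\<close> by (simp add: measure_distr)
    finally show "prob {\<omega> \<in> space M. R < \<bar>b \<bullet> X n \<omega>\<bar>} \<le> 1 / 8" using K(2)[of n] by simp
  qed simp
  have "\<bar>\<integral>\<omega>. (norm (X n \<omega>))\<^sup>2 \<partial>M\<bar> \<le> DIM('b) * (113 * R\<^sup>2)" for n
  proof -
    have "(\<integral>\<omega>. (norm (X n \<omega>))\<^sup>2 \<partial>M) = (\<Sum>b\<in>Basis. expectation (\<lambda>\<omega>. (b \<bullet> X n \<omega>)\<^sup>2))"
      by (rule gaussian_vector_second_moment(2)[OF X G])
    also have "\<dots> \<le> (\<Sum>b\<in>(Basis :: 'b set). 113 * R\<^sup>2)" by (rule sum_mono) (rule comp)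
    finally show ?thesis by simp
  qed
  then show ?thesis unfolding bounded_iff by auto
qed

lemma (in prob_space) norm_expectation_le_second_moment:
  fixes X :: "'a \<Rightarrow> 'b::euclidean_space"
  assumes "integrable M (\<lambda>\<omega>. (norm (X \<omega>))\<^sup>2)"
  shows "norm (expectation X) \<le> 1 + expectation (\<lambda>\<omega>. (norm (X \<omega>))\<^sup>2)"
proof -
  have "x \<le> 1 + x\<^sup>2" if "x \<ge> 0" for x :: real
    using that sum_squares_bound[of 1 x] by simp
  then have "expectation (\<lambda>\<omega>. norm (X \<omega>)) \<le> expectation (\<lambda>\<omega>. 1 + (norm (X \<omega>))\<^sup>2)"
    using assms by (intro integral_mono') auto
  from order_trans[OF integral_norm_bound this] show ?thesis
    using assms by (simp add: prob_space)
qed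

section \<open>Asymptotic independence and vanishing covariances\<close>

lemma abs_cos_diff_le: "\<bar>cos x - cos y\<bar> \<le> \<bar>x - y\<bar>" for x y :: real
proof -
  have "\<bar>cos x - cos y\<bar> = 2 * (\<bar>sin ((x + y) / 2)\<bar> * \<bar>sin ((y - x) / 2)\<bar>)"
    by (simp add: cos_diff_cos abs_mult)
  also have "\<dots> \<le> 2 * (1 * \<bar>(y - x) / 2\<bar>)"
    by (intro mult_left_mono mult_mono abs_sin_x_le_abs_x) auto
  finally show ?thesis by (simp add: abs_minus_commute)
qed

theorem proposition7:
  fixes M :: "'w measure"
    and X :: "nat \<Rightarrow> 'w \<Rightarrow> real ^ 'm"
    and Y :: "nat \<Rightarrow> 'w \<Rightarrow> real ^ 'k"
    and a :: "nat \<Rightarrow> real ^ 'm"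
    and b :: "nat \<Rightarrow> real ^ 'k"
    and r :: "nat \<Rightarrow> 'm \<Rightarrow> 'k \<Rightarrow> real"
  assumes "prob_space M"
    and "\<And>n. X n \<in> borel_measurable M"
    and "\<And>n. Y n \<in> borel_measurable M"
    and "\<And>n. gaussian (distr M borel (\<lambda>\<omega>. (X n \<omega>, Y n \<omega>)))"
    and "\<And>n. a n = (\<integral>\<omega>. X n \<omega> \<partial>M)"
    and "\<And>n. b n = (\<integral>\<omega>. Y n \<omega> \<partial>M)"
    and "\<And>n i j. r n i j = covariance M (\<lambda>\<omega>. X n \<omega> $ i) (\<lambda>\<omega>. Y n \<omega> $ j)"
  shows "(tight_seq (\<lambda>n. distr M borel (X n)) \<and> tight_seq (\<lambda>n. distr M borel (Y n)) \<and> AI1 M X Y)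
     \<longleftrightarrow>
     (bounded (range a) \<and> bounded (range b) \<and>
      bounded (range (\<lambda>n. \<integral>\<omega>. (norm (X n \<omega>))\<^sup>2 \<partial>M)) \<and>
      bounded (range (\<lambda>n. \<integral>\<omega>. (norm (Y n \<omega>))\<^sup>2 \<partial>M)) \<and>
      (\<forall>i j. (\<lambda>n. r n i j) \<longlonglongrightarrow> 0))"
proof -
  interpret prob_space M by fact
  note X [measurable] = assms(2) and Y [measurable] = assms(3)
  note r = assms(7)
  have G: "gaussian_real (distr M borel (\<lambda>\<omega>. u \<bullet> X n \<omega> + v \<bullet> Y n \<omega>))" for u v n
    by (rule gaussian_pair_linear[OF X Y assms(4)])
  have GX: "gaussian_real (distr M borel (\<lambda>\<omega>. u \<bullet> X n \<omega>))" for u n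
    using G[of u n 0] by simp
  have GY: "gaussian_real (distr M borel (\<lambda>\<omega>. v \<bullet> Y n \<omega>))" for v n
    using G[of 0 n v] by simp
  have mX: "(\<lambda>\<omega>. u \<bullet> X n \<omega>) \<in> borel_measurable M"
    and mY: "(\<lambda>\<omega>. v \<bullet> Y n \<omega>) \<in> borel_measurable M" for u v n
    by simp_all
  note intX = gaussian_vector_second_moment(1)[OF X GX]
  note intY = gaussian_vector_second_moment(1)[OF Y GY]
  define \<Delta> where "\<Delta> n u v = expectation (\<lambda>\<omega>. iexp (u \<bullet> X n \<omega> + v \<bullet> Y n \<omega>)) -
      expectation (\<lambda>\<omega>. iexp (u \<bullet> X n \<omega>)) * expectation (\<lambda>\<omega>. iexp (v \<bullet> Y n \<omega>))" for n u v
  have norm_\<Delta>: "norm (\<Delta> n u v) =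
      exp (- (variance (\<lambda>\<omega>. u \<bullet> X n \<omega>) + variance (\<lambda>\<omega>. v \<bullet> Y n \<omega>)) / 2) *
      \<bar>exp (- covariance M (\<lambda>\<omega>. u \<bullet> X n \<omega>) (\<lambda>\<omega>. v \<bullet> Y n \<omega>)) - 1\<bar>" for n u v
    unfolding \<Delta>_def by (rule norm_char_add_diff_gaussian[OF mX mY GX GY G])
  \<comment> \<open>\<open>J\<close> is the joint law and \<open>Q\<close> the product of the marginals\<close>
  define J where "J n = distr M borel (\<lambda>\<omega>. (X n \<omega>, Y n \<omega>))" for n
  define Q where "Q n = distr M borel (X n) \<Otimes>\<^sub>M distr M borel (Y n)" for n
  have cos_\<Delta>: "(\<integral>p. cos ((u, v) \<bullet> p + c) \<partial>J n) - (\<integral>p. cos ((u, v) \<bullet> p + c) \<partial>Q n) =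
      Re (cis c * \<Delta> n u v)" for u v c n
    unfolding J_def Q_def \<Delta>_def by (rule integral_cos_joint_minus_product[OF X Y])
  show ?thesis
  proof (intro iffI; (elim conjE)?)
    assume tX: "tight_seq (\<lambda>n. distr M borel (X n))" and tY: "tight_seq (\<lambda>n. distr M borel (Y n))"
      and AI: "AI1 M X Y"
    have bX: "bounded (range (\<lambda>n. \<integral>\<omega>. (norm (X n \<omega>))\<^sup>2 \<partial>M))"
      by (rule bounded_second_moment_of_tight_gaussian[OF X GX tX])
    have bY: "bounded (range (\<lambda>n. \<integral>\<omega>. (norm (Y n \<omega>))\<^sup>2 \<partial>M))"
      by (rule bounded_second_moment_of_tight_gaussian[OF Y GY tY])
    obtain C where C: "\<And>n. \<bar>\<integral>\<omega>. (norm (X n \<omega>))\<^sup>2 \<partial>M\<bar> \<le> C"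
      using bX unfolding bounded_iff by auto
    obtain D where D: "\<And>n. \<bar>\<integral>\<omega>. (norm (Y n \<omega>))\<^sup>2 \<partial>M\<bar> \<le> D"
      using bY unfolding bounded_iff by auto
    have "norm (a n) \<le> 1 + C" for n
      unfolding assms(5) using norm_expectation_le_second_moment[OF intX, of n] C[of n] by linarith
    then have "bounded (range a)" unfolding bounded_iff by auto
    moreover have "norm (b n) \<le> 1 + D" for n
      unfolding assms(6) using norm_expectation_le_second_moment[OF intY, of n] D[of n] by linarith
    then have "bounded (range b)" unfolding bounded_iff by auto
    moreover have "(\<lambda>n. r n i j) \<longlonglongrightarrow> 0" for i j
    proof -
      let ?u = "axis i 1 :: real ^ 'm" and ?v = "axis j 1 :: real ^ 'k"
      have "(\<lambda>n. Re (cis c * \<Delta> n ?u ?v)) \<longlonglongrightarrow> 0" for c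
      proof -
        let ?h = "\<lambda>p. cos ((?u, ?v) \<bullet> p + c)"
        have "uniformly_continuous_on UNIV ?h"
        proof (rule lipschitz_on_uniformly_continuous)
          show "(norm (?u, ?v))-lipschitz_on UNIV ?h"
          proof (rule lipschitz_onI)
            fix p q :: "(real ^ 'm) \<times> (real ^ 'k)"
            have "\<bar>cos x - cos y\<bar> \<le> \<bar>x - y\<bar>" for x y :: real
              by (rule abs_cos_diff_le)
            then have "dist (?h p) (?h q) \<le> \<bar>(?u, ?v) \<bullet> (p - q)\<bar>"
              unfolding dist_real_def by (metis add_diff_cancel_right inner_diff_right)
            also have "\<dots> \<le> norm (?u, ?v) * dist p q"
              unfolding dist_norm by (rule Cauchy_Schwarz_ineq2)
            finally show "dist (?h p) (?h q) \<le> norm (?u, ?v) * dist p q" .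
          qed simp
        qed
        moreover have "bounded (range ?h)"
          unfolding bounded_iff by (intro exI[of _ 1]) auto
        ultimately show ?thesis
          using AI unfolding AI1_def J_def[symmetric] Q_def[symmetric] cos_\<Delta>[symmetric] by blast
      qed
      \<comment> \<open>the phases \<open>0\<close> and \<open>- pi / 2\<close> select the real and the imaginary part\<close>
      from this[of 0] this[of "- pi / 2"]
      have "(\<lambda>n. Re (\<Delta> n ?u ?v)) \<longlonglongrightarrow> 0" "(\<lambda>n. Im (\<Delta> n ?u ?v)) \<longlonglongrightarrow> 0"
        by (simp_all add: cis.ctr cis_conv_exp[symmetric])
      then have "(\<lambda>n. \<Delta> n ?u ?v) \<longlonglongrightarrow> 0"
        unfolding tendsto_complex_iff by simp
      then have \<Delta>0: "(\<lambda>n. norm (\<Delta> n ?u ?v)) \<longlonglongrightarrow> 0" by (simp add: tendsto_norm_zero)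
      have var_le: "variance U \<le> expectation (\<lambda>\<omega>. (norm (Z \<omega>))\<^sup>2)"
        if "gaussian_real (distr M borel U)" "U \<in> borel_measurable M" "\<And>\<omega>. \<bar>U \<omega>\<bar> \<le> norm (Z \<omega>)"
          "integrable M (\<lambda>\<omega>. (norm (Z \<omega>))\<^sup>2)"
        for U and Z :: "'w \<Rightarrow> 'z::real_normed_vector"
      proof -
        note m = gaussian_real_moments(1,2)[OF that(2,1)]
        have "variance U \<le> expectation (\<lambda>\<omega>. (U \<omega>)\<^sup>2)" using variance_eq[OF m] by simp
        also have "\<dots> \<le> expectation (\<lambda>\<omega>. (norm (Z \<omega>))\<^sup>2)"
          using m that by (intro integral_mono) (auto simp: abs_le_square_iff[symmetric])
        finally show ?thesis .
      qed
      have "variance (\<lambda>\<omega>. ?u \<bullet> X n \<omega>) \<le> expectation (\<lambda>\<omega>. (norm (X n \<omega>))\<^sup>2)" for n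
        by (rule var_le[OF GX mX _ intX]) (simp add: inner_axis' component_le_norm_cart)
      moreover have "variance (\<lambda>\<omega>. ?v \<bullet> Y n \<omega>) \<le> expectation (\<lambda>\<omega>. (norm (Y n \<omega>))\<^sup>2)" for n
        by (rule var_le[OF GY mY _ intY]) (simp add: inner_axis' component_le_norm_cart)
      ultimately have vb: "variance (\<lambda>\<omega>. ?u \<bullet> X n \<omega>) \<le> C" "variance (\<lambda>\<omega>. ?v \<bullet> Y n \<omega>) \<le> D" for n
        using C D by (meson abs_le_D1 order_trans)+
      have "exp (- (C + D) / 2) \<le>
        exp (- (variance (\<lambda>\<omega>. ?u \<bullet> X n \<omega>) + variance (\<lambda>\<omega>. ?v \<bullet> Y n \<omega>)) / 2)" for n
        unfolding exp_le_cancel_iff by (intro divide_right_mono le_imp_neg_le add_mono vb) simp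
      from mult_right_mono[OF this abs_ge_zero]
      \<comment> \<open>the Gaussian factor is bounded below, so \<open>\<Delta>\<close> controls the covariance\<close>
      have bound: "exp (- (C + D) / 2) * \<bar>exp (- r n i j) - 1\<bar> \<le> norm (\<Delta> n ?u ?v)" for n
        unfolding norm_\<Delta> r by (simp add: inner_axis')
      have le: "\<bar>exp (- r n i j) - 1\<bar> \<le> exp ((C + D) / 2) * norm (\<Delta> n ?u ?v)" for n
      proof -
        have "exp ((C + D) / 2) * exp (- (C + D) / 2) = 1"
          by (simp add: exp_add[symmetric] add_divide_distrib[symmetric])
        then have "\<bar>exp (- r n i j) - 1\<bar> =
            exp ((C + D) / 2) * (exp (- (C + D) / 2) * \<bar>exp (- r n i j) - 1\<bar>)"
          by (simp only: mult.assoc[symmetric] mult_1_left)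
        also have "\<dots> \<le> exp ((C + D) / 2) * norm (\<Delta> n ?u ?v)"
          by (intro mult_left_mono bound) simp
        finally show ?thesis .
      qed
      have "(\<lambda>n. exp (- r n i j) - 1) \<longlonglongrightarrow> 0"
        by (rule Lim_null_comparison[OF _ tendsto_mult_right_zero[OF \<Delta>0, of "exp ((C + D) / 2)"]])
           (simp add: le)
      then have "(\<lambda>n. exp (- r n i j)) \<longlonglongrightarrow> 1" by (simp add: LIM_zero_iff)
      from tendsto_ln[OF this] have "(\<lambda>n. - r n i j) \<longlonglongrightarrow> 0" by simp
      then show ?thesis using tendsto_minus_cancel_left[of "\<lambda>n. r n i j" 0] by simp
    qed
    ultimately show "bounded (range a) \<and> bounded (range b) \<and>
      bounded (range (\<lambda>n. \<integral>\<omega>. (norm (X n \<omega>))\<^sup>2 \<partial>M)) \<and>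
      bounded (range (\<lambda>n. \<integral>\<omega>. (norm (Y n \<omega>))\<^sup>2 \<partial>M)) \<and>
      (\<forall>i j. (\<lambda>n. r n i j) \<longlonglongrightarrow> 0)" using bX bY by blast
  next
    assume bX: "bounded (range (\<lambda>n. \<integral>\<omega>. (norm (X n \<omega>))\<^sup>2 \<partial>M))"
      and bY: "bounded (range (\<lambda>n. \<integral>\<omega>. (norm (Y n \<omega>))\<^sup>2 \<partial>M))"
      and r0: "\<forall>i j. (\<lambda>n. r n i j) \<longlonglongrightarrow> 0"
    have tX: "tight_seq (\<lambda>n. distr M borel (X n))"
      by (rule tight_seq_second_moment[OF X intX bX])
    have tY: "tight_seq (\<lambda>n. distr M borel (Y n))"
      by (rule tight_seq_second_moment[OF Y intY bY])
    have pX: "prob_space (distr M borel (X n))" and pY: "prob_space (distr M borel (Y n))" for n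
      by (simp_all add: prob_space_distr)
    have J: "prob_space (J n)" "sets (J n) = sets borel" for n
      by (auto simp: J_def intro!: prob_space_distr)
    have "prob_space (Q n)" for n
    proof -
      interpret pair_prob_space "distr M borel (X n)" "distr M borel (Y n)"
        using pX pY by (simp add: pair_prob_space_def pair_sigma_finite_def prob_space_imp_sigma_finite)
      show ?thesis unfolding Q_def by (rule prob_space_axioms)
    qed
    moreover have "sets (Q n) = sets borel" for n
      unfolding Q_def borel_prod[symmetric] by (intro sets_pair_measure_cong) auto
    ultimately have Q: "prob_space (Q n)" "sets (Q n) = sets borel" for n by auto
    have "distr (J n) borel fst = distr M borel (X n)" "distr (J n) borel snd = distr M borel (Y n)" for n
      by (simp_all add: J_def distr_distr comp_def borel_measurable_continuous_onI continuous_on_fst continuous_on_snd)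
    then have tJ: "tight_seq J"
      using tX tY by (intro tight_seq_prod J) simp_all
    have "distr (Q n) borel fst = distr M borel (X n)" for n
    proof -
      have "distr (Q n) borel fst = distr (Q n) (distr M borel (X n)) fst"
        by (intro distr_cong) auto
      then show ?thesis
        unfolding Q_def using prob_space.distr_pair_fst[OF pY] by metis
    qed
    moreover have "distr (Q n) borel snd = distr M borel (Y n)" for n
    proof -
      have "distr (Q n) borel snd = distr (Q n) (distr M borel (Y n)) snd"
        by (intro distr_cong) auto
      then show ?thesis
        unfolding Q_def using distr_pair_measure_snd[OF pX pY] by metis
    qed
    ultimately have tQ: "tight_seq Q"
      using tX tY by (intro tight_seq_prod Q) simp_all
    have "(\<lambda>n. \<Delta> n u v) \<longlonglongrightarrow> 0" for u v
    proof -
      let ?c = "\<lambda>n. covariance M (\<lambda>\<omega>. u \<bullet> X n \<omega>) (\<lambda>\<omega>. v \<bullet> Y n \<omega>)"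
      have "?c n = (\<Sum>i\<in>UNIV. \<Sum>j\<in>UNIV. u $ i * v $ j * r n i j)" for n
      proof -
        have "integrable M (\<lambda>\<omega>. X n \<omega> $ i)" "integrable M (\<lambda>\<omega>. (X n \<omega> $ i)\<^sup>2)" for i
          using gaussian_real_moments(1,2)[OF mX GX, of "axis i 1" n] by (simp_all add: inner_axis')
        moreover have "integrable M (\<lambda>\<omega>. Y n \<omega> $ j)" "integrable M (\<lambda>\<omega>. (Y n \<omega> $ j)\<^sup>2)" for j
          using gaussian_real_moments(1,2)[OF mY GY, of "axis j 1" n] by (simp_all add: inner_axis')
        ultimately show ?thesis
          unfolding r inner_vec_def inner_real_def
          by (intro covariance_sum) (simp_all add: borel_measurable_integrable)
      qed
      moreover have "(\<lambda>n. \<Sum>i\<in>UNIV. \<Sum>j\<in>UNIV. u $ i * v $ j * r n i j) \<longlonglongrightarrow> 0"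
        using r0 by (intro tendsto_null_sum tendsto_mult_right_zero) auto
      ultimately have "?c \<longlonglongrightarrow> 0" by simp
      then have "(\<lambda>n. \<bar>exp (- ?c n) - 1\<bar>) \<longlonglongrightarrow> \<bar>exp (- 0) - 1\<bar>"
        by (intro tendsto_intros)
      then have lim: "(\<lambda>n. \<bar>exp (- ?c n) - 1\<bar>) \<longlonglongrightarrow> 0" by simp
      have le: "norm (\<Delta> n u v) \<le> \<bar>exp (- ?c n) - 1\<bar>" for n
      proof -
        have "0 \<le> variance (\<lambda>\<omega>. u \<bullet> X n \<omega>) + variance (\<lambda>\<omega>. v \<bullet> Y n \<omega>)"
          by (intro add_nonneg_nonneg variance_positive)
        then have "exp (- (variance (\<lambda>\<omega>. u \<bullet> X n \<omega>) + variance (\<lambda>\<omega>. v \<bullet> Y n \<omega>)) / 2) \<le> 1"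
          unfolding exp_le_one_iff by (intro divide_nonpos_pos) (simp_all only: neg_le_0_iff_le zero_less_numeral)
        then show ?thesis
          unfolding norm_\<Delta> by (rule mult_left_le_one_le[OF abs_ge_zero exp_ge_zero])
      qed
      show ?thesis
        by (rule Lim_null_comparison[OF always_eventually[OF allI[OF le]] lim])
    qed
    note \<Delta>0 = this
    have "(\<lambda>n. Re (cis c * \<Delta> n u v)) \<longlonglongrightarrow> 0" for u v c
      using tendsto_Re[OF tendsto_mult_right_zero[OF \<Delta>0[of u v], of "cis c"]] by simp
    then have cos0: "(\<lambda>n. (\<integral>p. cos (l \<bullet> p + c) \<partial>J n) - (\<integral>p. cos (l \<bullet> p + c) \<partial>Q n)) \<longlonglongrightarrow> 0" for l c
      by (cases l) (simp only: cos_\<Delta>)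
    have "(\<lambda>n. (\<integral>p. h p \<partial>J n) - (\<integral>p. h p \<partial>Q n)) \<longlonglongrightarrow> 0"
      if "uniformly_continuous_on UNIV h" "bounded (range h)" for h :: "_ \<Rightarrow> real"
      by (rule tight_seq_integral_diff_tendsto_0
          [OF J tJ Q tQ cos0 uniformly_continuous_imp_continuous[OF that(1)] that(2)])
    then have "AI1 M X Y"
      unfolding AI1_def J_def Q_def by blast
    then show "tight_seq (\<lambda>n. distr M borel (X n)) \<and> tight_seq (\<lambda>n. distr M borel (Y n)) \<and> AI1 M X Y"
      using tX tY by blast
  qed
qed

end
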